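(* Let $n\ge 1$ be an integer, let $p\geq 1$, let $s,\mu,\omega>0$ be real numbers, and let $f,g,h:\mathbb{R}^n\rightarrow [0,\infty)$ be (Lebesgue) integrable functions with nonempty supports. Let $q$ be the Hölder conjugate of $p$. Suppose that for all $x\in \operatorname{supp}f$, $y\in\operatorname{supp}g$ and $\lambda\in [0,1]$, $$h\big((1-\lambda)^{\frac{1}{q}}\mu^{\frac{1}{p}} x+\lambda^{\frac{1}{q}}\omega^{\frac{1}{p}} y\big)^{\frac{1}{s}}\geq (1-\lambda)^{\frac{1}{q}}\mu^{\frac{1}{p}} f(x)^{\frac{1}{s}}+\lambda^{\frac{1}{q}}\omega^{\frac{1}{p}} g(y)^{\frac{1}{s}}.$$ Then $$\left(\int_{\mathbb{R}^n} h\right)^{\frac{p}{n+s}} \geq \mu\left(\int_{\mathbb{R}^n} f\right)^{\frac{p}{n+s}}+\omega\left(\int_{\mathbb{R}^n} g\right)^{\frac{p}{n+s}}.$$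
   Context: Integrals are with respect to Lebesgue measure on $\mathbb{R}^n$. For a nonnegative function $f$ on $\mathbb{R}^n$, $\operatorname{supp} f$ denotes the closure of $\{x\in\mathbb{R}^n: f(x)>0\}$. The Hölder conjugate $q$ of $p$ is defined by $\frac1p+\frac1q=1$; when $p=1$, $q=\infty$ and $1/q$ is defined as $0$, so that $(1-\lambda)^{1/q}=\lambda^{1/q}=1$ for all $\lambda\in[0,1]$ (convention $0^0=1$). *)

theory Defs
  imports "HOL-Analysis.Analysis"
begin

definition supp :: "('a::topological_space \<Rightarrow> real) \<Rightarrow> 'a set" where
  "supp f = closure {x. f x > 0}"

text \<open>The condition \<open>1 \<le> q\<close> excludes \<open>q = -\<infinity>\<close>, whose inverse in
  \<^typ>\<open>ereal\<close> is also \<open>0\<close>; thus \<open>p = 1\<close> has the unique conjugate \<open>q = \<infinity>\<close>.\<close>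

definition holder_conjugate :: "real \<Rightarrow> ereal \<Rightarrow> bool" where
  "holder_conjugate p q \<longleftrightarrow> 1 \<le> q \<and> 1 / ereal p + 1 / q = 1"

text \<open>Real powers of \<open>t \<ge> 0\<close> with exponent \<open>a \<ge> 0\<close> and the convention that \<open>0\<close>
  to the \<open>0\<close> is \<open>1\<close>, in contrast to \<open>0 powr 0 = 0\<close>.\<close>

definition rpow :: "real \<Rightarrow> real \<Rightarrow> real" where
  "rpow t a = (if a = 0 then 1 else t powr a)"

end

theory Submission
  imports Defs
begin

text \<open>
  The inequality is the \<open>L\<^sub>p\<close> form of the Borell--Brascamp--Lieb inequality. For a fixed parameter \<open>t\<close>,
  write \<open>a\<close> and \<open>b\<close> for the coefficients of \<open>x\<close> and \<open>y\<close> in the assumption, and \<open>d = n + s\<close>. The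
  Borell--Brascamp--Lieb inequality \<open>borell_brascamp_lieb\<close> states that
  \<open>(\<integral>h) powr (1/d) \<ge> a * (\<integral>f) powr (1/d) + b * (\<integral>g) powr (1/d)\<close>.
  The left side does not depend on \<open>t\<close>, and the maximum of the right side over \<open>t\<close> is, by the equality
  case of Hoelder's inequality (\<open>holder_equality_weight\<close>), the \<open>L\<^sub>p\<close> sum
  \<open>(\<mu> * (\<integral>f) powr (p/d) + \<omega> * (\<integral>g) powr (p/d)) powr (1/p)\<close>.
  If \<open>\<integral>f\<close> or \<open>\<integral>g\<close> vanishes, an endpoint \<open>t \<in> {0, 1}\<close> and an affine change of variables suffice
  (\<open>integral_powr_le_of_affine_dominated\<close>).

  The Borell--Brascamp--Lieb inequality for real \<open>s > 0\<close> follows from the Prekopa--Leindler inequality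
  \<open>prekopa_leindler\<close>: after \<open>f\<close> and \<open>g\<close> are rescaled to integral \<open>1\<close>, the power mean in its
  assumption may be replaced by the smaller geometric mean. The Prekopa--Leindler inequality is stable
  under iterated integration, hence reduces to the line (\<open>prekopa_leindler_PiM\<close>), where it is an integral
  over levels of the Brunn--Minkowski inequality \<open>brunn_minkowski_real\<close> for the level sets.

  Iterated integration needs Borel functions. Lebesgue measurable ones are first replaced by Borel
  minorants \<open>f\<close>, \<open>g\<close> and a Borel majorant \<open>h\<close> that may be infinite on a null set; for this reason the
  inequalities on which the Borell--Brascamp--Lieb inequality rests are stated for functions with values
  in \<^typ>\<open>ennreal\<close>.
\<close>

section \<open>The Brunn--Minkowski inequality on the line\<close>

lemma emeasure_affine_vimage:
  fixes K :: "real set"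
  assumes "K \<in> sets borel" "0 < c"
  shows "emeasure lborel {z. (z - t) / c \<in> K} = ennreal c * emeasure lborel K"
proof -
  have [measurable]: "K \<in> sets borel" by fact
  have [measurable]: "{z. (z - t) / c \<in> K} \<in> sets borel" by measurable
  have ind: "indicator {z. (z - t) / c \<in> K} (t + c * x) = (indicator K x :: ennreal)" for x
    using assms by (simp add: indicator_def)
  have "emeasure lborel {z. (z - t) / c \<in> K}
      = (\<integral>\<^sup>+z. indicator {z. (z - t) / c \<in> K} z \<partial>lborel)"
    by simp
  also have "\<dots> = ennreal c * (\<integral>\<^sup>+x. indicator K x \<partial>lborel)"
    using assms by (subst nn_integral_real_affine[where c=c and t=t]) (simp_all add: ind)
  finally show ?thesis by simp
qed

text \<open>Inner regularity is available for finite measures; it is applied to the restriction of Lebesgue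
  measure to a large ball.\<close>

lemma compact_subset_emeasure_gt:
  fixes A :: "'a::euclidean_space set"
  assumes [measurable]: "A \<in> sets borel" and u: "u < emeasure lborel A"
  obtains K where "compact K" "K \<subseteq> A" "u < emeasure lborel K"
proof -
  let ?B = "\<lambda>k::nat. cball (0::'a) (real k)"
  have "(SUP k. emeasure lborel (A \<inter> ?B k)) = emeasure lborel (\<Union>k. A \<inter> ?B k)"
    by (rule SUP_emeasure_incseq) (auto simp: incseq_def intro: order_trans)
  also have "(\<Union>k. A \<inter> ?B k) = A"
    using real_arch_simple by auto
  finally have "u < (SUP k. emeasure lborel (A \<inter> ?B k))"
    using u by simp
  then obtain k where k: "u < emeasure lborel (A \<inter> ?B k)"
    unfolding less_SUP_iff by blast
  have [measurable]: "?B k \<in> sets borel" by simp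
  define M where "M = density lborel (indicator (?B k))"
  have M: "emeasure M X = emeasure lborel (X \<inter> ?B k)" if "X \<in> sets borel" for X
    using that unfolding M_def
    by (subst emeasure_density) (simp_all add: Int_commute indicator_inter_arith[symmetric])
  have "emeasure M (space M) \<noteq> \<infinity>"
    using M[of UNIV] emeasure_lborel_cball_finite[of "0::'a" "real k"] by (auto simp: M_def)
  then have "emeasure M A = (SUP K \<in> {K. K \<subseteq> A \<and> compact K}. emeasure M K)"
    by (intro inner_regular) (auto simp: M_def)
  then obtain K where K: "K \<subseteq> A" "compact K" "u < emeasure M K"
    using k M[of A] by (auto simp: less_SUP_iff)
  have "u < emeasure lborel (K \<inter> ?B k)"
    using K M[of K] by (simp add: borel_compact)
  also have "\<dots> \<le> emeasure lborel K"
    using K by (intro emeasure_mono) (auto simp: borel_compact)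
  finally show ?thesis using K that by blast
qed

text \<open>The set \<open>C\<close> contains the translate of \<open>u K\<close> by \<open>v min L\<close> and the translate of \<open>v L\<close> by
  \<open>u max K\<close>. The first lies to the left of \<open>c = u max K + v min L\<close> and the second to the right,
  so that they overlap in at most one point and their lengths add up.\<close>

lemma emeasure_weighted_sum_compact:
  fixes K L C :: "real set"
  assumes K: "compact K" "K \<noteq> {}" and L: "compact L" "L \<noteq> {}"
    and [measurable]: "C \<in> sets borel" and "0 < u" "0 < v"
    and C: "\<And>x y. x \<in> K \<Longrightarrow> y \<in> L \<Longrightarrow> u * x + v * y \<in> C"
  shows "ennreal u * emeasure lborel K + ennreal v * emeasure lborel L \<le> emeasure lborel C"
proof -
  have [measurable]: "K \<in> sets borel" "L \<in> sets borel"
    using K L by (simp_all add: borel_compact)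
  obtain \<alpha> where \<alpha>: "\<alpha> \<in> K" "\<And>x. x \<in> K \<Longrightarrow> x \<le> \<alpha>"
    using compact_attains_sup[OF K] by blast
  obtain \<beta> where \<beta>: "\<beta> \<in> L" "\<And>y. y \<in> L \<Longrightarrow> \<beta> \<le> y"
    using compact_attains_inf[OF L] by blast
  define c where "c = u * \<alpha> + v * \<beta>"
  define S where "S = {z. (z - v * \<beta>) / u \<in> K}"
  define T where "T = {z. (z - u * \<alpha>) / v \<in> L}"
  have [measurable]: "S \<in> sets borel" "T \<in> sets borel"
    unfolding S_def T_def by measurable
  have "z \<le> c" if "z \<in> S" for z
    using \<alpha>(2)[of "(z - v * \<beta>) / u"] that \<open>0 < u\<close> by (simp add: S_def c_def field_simps)
  moreover have "c \<le> z" if "z \<in> T" for z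
    using \<beta>(2)[of "(z - u * \<alpha>) / v"] that \<open>0 < v\<close> by (simp add: T_def c_def field_simps)
  ultimately have disj: "(S - {c}) \<inter> T = {}"
    by (auto intro: antisym)
  have "z \<in> C" if "z \<in> S" for z
    using C[of "(z - v * \<beta>) / u" \<beta>] that \<beta>(1) \<open>0 < u\<close> by (simp add: S_def)
  moreover have "z \<in> C" if "z \<in> T" for z
    using C[of \<alpha> "(z - u * \<alpha>) / v"] that \<alpha>(1) \<open>0 < v\<close> by (simp add: T_def)
  ultimately have sub: "(S - {c}) \<union> T \<subseteq> C" by blast
  have "ennreal u * emeasure lborel K + ennreal v * emeasure lborel L
      = emeasure lborel S + emeasure lborel T"
    using \<open>0 < u\<close> \<open>0 < v\<close> by (simp add: S_def T_def emeasure_affine_vimage)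
  also have "emeasure lborel S = emeasure lborel (S - {c})"
    by (rule emeasure_Diff_null_set[symmetric]) (auto simp: null_sets_def)
  also have "emeasure lborel (S - {c}) + emeasure lborel T = emeasure lborel ((S - {c}) \<union> T)"
    using disj by (intro plus_emeasure) auto
  also have "\<dots> \<le> emeasure lborel C"
    using sub by (intro emeasure_mono) auto
  finally show ?thesis .
qed

text \<open>The compact sets are required to be nonempty because the Brunn--Minkowski inequality fails for an
  empty summand.\<close>

lemma emeasure_eq_SUP_nonempty_compact:
  fixes A :: "'a::euclidean_space set"
  assumes A: "A \<in> sets borel" "A \<noteq> {}"
  shows "emeasure lborel A = (SUP K \<in> {K. compact K \<and> K \<noteq> {} \<and> K \<subseteq> A}. emeasure lborel K)"
proof (rule antisym)
  show "(SUP K \<in> {K. compact K \<and> K \<noteq> {} \<and> K \<subseteq> A}. emeasure lborel K) \<le> emeasure lborel A"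
    using A by (auto intro!: SUP_least emeasure_mono)
  show "emeasure lborel A \<le> (SUP K \<in> {K. compact K \<and> K \<noteq> {} \<and> K \<subseteq> A}. emeasure lborel K)"
  proof (rule dense_le)
    fix w assume "w < emeasure lborel A"
    then obtain K where "compact K" "K \<subseteq> A" "w < emeasure lborel K"
      using compact_subset_emeasure_gt[OF A(1)] by blast
    then show "w \<le> (SUP K \<in> {K. compact K \<and> K \<noteq> {} \<and> K \<subseteq> A}. emeasure lborel K)"
      by (intro SUP_upper2[of K]) auto
  qed
qed

lemma brunn_minkowski_real:
  fixes A B C :: "real set"
  assumes A: "A \<in> sets borel" "A \<noteq> {}" and B: "B \<in> sets borel" "B \<noteq> {}"
    and C: "C \<in> sets borel" and "0 < u" "0 < v"
    and sum: "\<And>x y. x \<in> A \<Longrightarrow> y \<in> B \<Longrightarrow> u * x + v * y \<in> C"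
  shows "ennreal u * emeasure lborel A + ennreal v * emeasure lborel B \<le> emeasure lborel C"
proof -
  let ?F = "\<lambda>X. {K::real set. compact K \<and> K \<noteq> {} \<and> K \<subseteq> X}"
  have ne: "?F A \<noteq> {}" "?F B \<noteq> {}"
    using A(2) B(2) compact_sing by blast+
  have "ennreal u * emeasure lborel A + ennreal v * emeasure lborel B
     = (SUP L\<in>?F B. SUP K\<in>?F A. ennreal u * emeasure lborel K + ennreal v * emeasure lborel L)"
    using ne by (simp add: emeasure_eq_SUP_nonempty_compact[OF A]
        emeasure_eq_SUP_nonempty_compact[OF B] SUP_mult_left_ennreal
        ennreal_SUP_add_left[symmetric] ennreal_SUP_add_right)
  also have "\<dots> \<le> emeasure lborel C"
    using assms by (intro SUP_least emeasure_weighted_sum_compact) auto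
  finally show ?thesis .
qed

section \<open>The Prekopa--Leindler inequality on the line\<close>

text \<open>The inequality \<open>F powr u * G powr v \<le> H\<close> for extended values, with the convention that the left
  side is \<open>0\<close> as soon as \<open>F\<close> or \<open>G\<close> is. Testing it on finite positive minorants of \<open>F\<close> and \<open>G\<close>
  avoids powers of infinite values, so that partial integrals, which may be infinite, can be
  substituted for \<open>F\<close>, \<open>G\<close> and \<open>H\<close> in the induction on the dimension.\<close>

definition geometric_mean_le :: "real \<Rightarrow> real \<Rightarrow> ennreal \<Rightarrow> ennreal \<Rightarrow> ennreal \<Rightarrow> bool" where
  "geometric_mean_le u v F G H \<longleftrightarrow>
    (\<forall>a b. 0 < a \<longrightarrow> 0 < b \<longrightarrow> ennreal a \<le> F \<longrightarrow> ennreal b \<le> G \<longrightarrow> ennreal (a powr u * b powr v) \<le> H)"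

lemma emeasure_linear_sublevel:
  fixes t :: ennreal and M :: real
  assumes "0 < M"
  shows "emeasure lborel {\<tau>. 0 < \<tau> \<and> \<tau> < 1 \<and> ennreal (M * \<tau>) \<le> t} = min 1 (ennreal (1 / M) * t)"
proof (cases t)
  case top
  have "{\<tau>::real. 0 < \<tau> \<and> \<tau> < 1} = {0<..<1}" by auto
  then show ?thesis using top assms by (simp add: ennreal_mult_top)
next
  case (real r)
  have eq: "ennreal (1 / M) * t = ennreal (r / M)"
    using real assms by (simp add: ennreal_mult[symmetric])
  have le: "ennreal (M * \<tau>) \<le> t \<longleftrightarrow> \<tau> \<le> r / M" for \<tau>
    using real assms by (simp add: field_simps)
  show ?thesis
  proof (cases "1 \<le> r / M")
    case True
    then have "{\<tau>. 0 < \<tau> \<and> \<tau> < 1 \<and> ennreal (M * \<tau>) \<le> t} = {0<..<1}"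
      unfolding le by auto
    then show ?thesis using True unfolding eq
      by (simp add: min_def ennreal_1[symmetric] del: ennreal_1)
  next
    case False
    then have "{\<tau>. 0 < \<tau> \<and> \<tau> < 1 \<and> ennreal (M * \<tau>) \<le> t} = {0<..r / M}"
      unfolding le by auto
    then show ?thesis using False real assms unfolding eq
      by (simp add: min_def ennreal_1[symmetric] del: ennreal_1)
  qed
qed

text \<open>Tonelli's theorem exchanges the integrals over levels and over points. Restricting the levels to
  \<open>M * \<tau>\<close> with \<open>0 < \<tau> < 1\<close> cuts \<open>f\<close> off at height \<open>M\<close>. With \<open>M\<close> the supremum of \<open>f\<close>
  this loses nothing, while for an arbitrary function it bounds the integral divided by \<open>M\<close>
  from below.\<close>

lemma layer_cake_truncated:
  fixes f :: "real \<Rightarrow> ennreal"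
  assumes [measurable]: "f \<in> borel_measurable borel" and "0 < M"
  shows "(\<integral>\<^sup>+\<tau>. indicator {0<..<1} \<tau> * emeasure lborel {x. ennreal (M * \<tau>) \<le> f x} \<partial>lborel)
    = (\<integral>\<^sup>+x. min 1 (ennreal (1 / M) * f x) \<partial>lborel)"
proof -
  let ?S = "\<lambda>\<tau> x. indicator {0<..<1} \<tau> * indicator {x. ennreal (M * \<tau>) \<le> f x} x :: ennreal"
  have [measurable]: "(\<lambda>p. ?S (snd p) (fst p)) \<in> borel_measurable (lborel \<Otimes>\<^sub>M lborel)"
    unfolding indicator_def by measurable
  have 1: "indicator {0<..<1} \<tau> * emeasure lborel {x. ennreal (M * \<tau>) \<le> f x}
    = (\<integral>\<^sup>+x. ?S \<tau> x \<partial>lborel)" for \<tau>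
    by (subst nn_integral_cmult) (auto)
  have 2: "(\<integral>\<^sup>+\<tau>. ?S \<tau> x \<partial>lborel) = min 1 (ennreal (1 / M) * f x)" for x
  proof -
    have "(\<integral>\<^sup>+\<tau>. ?S \<tau> x \<partial>lborel)
      = (\<integral>\<^sup>+\<tau>. indicator {\<tau>. 0 < \<tau> \<and> \<tau> < 1 \<and> ennreal (M * \<tau>) \<le> f x} \<tau> \<partial>lborel)"
      by (intro nn_integral_cong) (auto simp: indicator_def)
    also have "\<dots> = emeasure lborel {\<tau>. 0 < \<tau> \<and> \<tau> < 1 \<and> ennreal (M * \<tau>) \<le> f x}"
      by (rule nn_integral_indicator) measurable
    finally show ?thesis
      using emeasure_linear_sublevel[OF \<open>0 < M\<close>] by simp
  qed
  have "(\<integral>\<^sup>+\<tau>. \<integral>\<^sup>+x. ?S \<tau> x \<partial>lborel \<partial>lborel) = (\<integral>\<^sup>+x. \<integral>\<^sup>+\<tau>. ?S \<tau> x \<partial>lborel \<partial>lborel)"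
    by (rule lborel_pair.Fubini'[where f="\<lambda>p q. ?S q p"]) (simp add: split_beta')
  then show ?thesis unfolding 1 2 .
qed

text \<open>Both functions are measured in units of their suprema \<open>M\<close> and \<open>N\<close>: then the level sets
  \<open>{f \<ge> M \<tau>}\<close> and \<open>{g \<ge> N \<tau>}\<close> are nonempty for the same range \<open>\<tau> < 1\<close>, and their weighted sum
  lies in \<open>{h \<ge> c \<tau>}\<close> for \<open>c = M powr u * N powr v\<close>. Integrating the Brunn--Minkowski inequality
  over \<open>\<tau>\<close> gives an arithmetic mean as lower bound, which dominates the geometric mean.\<close>

lemma prekopa_leindler_real_bounded:
  fixes f g h :: "real \<Rightarrow> ennreal"
  assumes [measurable]: "f \<in> borel_measurable borel" "g \<in> borel_measurable borel"
      "h \<in> borel_measurable borel"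
    and uv: "0 < u" "0 < v" "u + v = 1"
    and "0 < M" and M: "ennreal M = (SUP x. f x)"
    and "0 < N" and N: "ennreal N = (SUP x. g x)"
    and h: "\<And>x y. geometric_mean_le u v (f x) (g y) (h (u * x + v * y))"
  shows "geometric_mean_le u v (\<integral>\<^sup>+x. f x \<partial>lborel) (\<integral>\<^sup>+x. g x \<partial>lborel) (\<integral>\<^sup>+x. h x \<partial>lborel)"
  unfolding geometric_mean_le_def
proof (intro allI impI)
  fix a b :: real
  assume ab: "0 < a" "0 < b" and a: "ennreal a \<le> (\<integral>\<^sup>+x. f x \<partial>lborel)"
    and b: "ennreal b \<le> (\<integral>\<^sup>+x. g x \<partial>lborel)"
  define c where "c = M powr u * N powr v"
  have "0 < c" using \<open>0 < M\<close> \<open>0 < N\<close> by (simp add: c_def)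
  have level: "ennreal u * emeasure lborel {x. ennreal (M * \<tau>) \<le> f x}
        + ennreal v * emeasure lborel {x. ennreal (N * \<tau>) \<le> g x}
      \<le> emeasure lborel {x. ennreal (c * \<tau>) \<le> h x}" if \<tau>: "0 < \<tau>" "\<tau> < 1" for \<tau>
  proof (rule brunn_minkowski_real)
    have "ennreal (M * \<tau>) < (SUP x. f x)"
      unfolding M[symmetric] using \<tau> \<open>0 < M\<close> by (simp add: ennreal_less_iff)
    then show "{x. ennreal (M * \<tau>) \<le> f x} \<noteq> {}"
      unfolding less_SUP_iff by (auto dest: less_imp_le)
    have "ennreal (N * \<tau>) < (SUP x. g x)"
      unfolding N[symmetric] using \<tau> \<open>0 < N\<close> by (simp add: ennreal_less_iff)
    then show "{x. ennreal (N * \<tau>) \<le> g x} \<noteq> {}"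
      unfolding less_SUP_iff by (auto dest: less_imp_le)
    fix x y
    assume "x \<in> {x. ennreal (M * \<tau>) \<le> f x}" "y \<in> {x. ennreal (N * \<tau>) \<le> g x}"
    then have "ennreal ((M * \<tau>) powr u * (N * \<tau>) powr v) \<le> h (u * x + v * y)"
      using h[of x y] \<tau> \<open>0 < M\<close> \<open>0 < N\<close> by (auto simp: geometric_mean_le_def)
    also have "(M * \<tau>) powr u * (N * \<tau>) powr v = c * \<tau> powr (u + v)"
      using \<tau> \<open>0 < M\<close> \<open>0 < N\<close> by (simp add: c_def powr_mult powr_add)
    finally show "u * x + v * y \<in> {x. ennreal (c * \<tau>) \<le> h x}"
      using \<tau> uv by simp
  qed (use uv in measurable)
  have full: "(\<integral>\<^sup>+\<tau>. indicator {0<..<1} \<tau> * emeasure lborel {x. ennreal (m * \<tau>) \<le> k x} \<partial>lborel)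
      = ennreal (1 / m) * (\<integral>\<^sup>+x. k x \<partial>lborel)"
    if [measurable]: "k \<in> borel_measurable borel" and m: "0 < m" "ennreal m = (SUP x. k x)"
    for m and k :: "real \<Rightarrow> ennreal"
  proof -
    have "ennreal (1 / m) * k x \<le> 1" for x
    proof -
      have "ennreal (1 / m) * k x \<le> ennreal (1 / m) * ennreal m"
        unfolding m(2) by (intro mult_left_mono SUP_upper) auto
      also have "\<dots> = 1" using m(1) by (simp add: ennreal_mult[symmetric])
      finally show ?thesis .
    qed
    then have "(\<integral>\<^sup>+x. min 1 (ennreal (1 / m) * k x) \<partial>lborel) = (\<integral>\<^sup>+x. ennreal (1 / m) * k x \<partial>lborel)"
      by (simp add: min_absorb2)
    then show ?thesis
      using m by (simp add: layer_cake_truncated nn_integral_cmult)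
  qed
  have "ennreal (u * (a / M) + v * (b / N)) = ennreal u * (ennreal (1 / M) * ennreal a)
      + ennreal v * (ennreal (1 / N) * ennreal b)"
    using ab uv \<open>0 < M\<close> \<open>0 < N\<close> by (simp add: ennreal_mult[symmetric] ennreal_plus[symmetric] del: ennreal_plus)
  also have "\<dots> \<le> ennreal u * (ennreal (1 / M) * (\<integral>\<^sup>+x. f x \<partial>lborel))
      + ennreal v * (ennreal (1 / N) * (\<integral>\<^sup>+x. g x \<partial>lborel))"
    by (intro add_mono mult_left_mono a b) auto
  also have "\<dots> = ennreal u * (\<integral>\<^sup>+\<tau>. indicator {0<..<1} \<tau> * emeasure lborel {x. ennreal (M * \<tau>) \<le> f x} \<partial>lborel)
      + ennreal v * (\<integral>\<^sup>+\<tau>. indicator {0<..<1} \<tau> * emeasure lborel {x. ennreal (N * \<tau>) \<le> g x} \<partial>lborel)"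
    using M N \<open>0 < M\<close> \<open>0 < N\<close> by (simp add: full)
  also have "\<dots> = (\<integral>\<^sup>+\<tau>. ennreal u * (indicator {0<..<1} \<tau> * emeasure lborel {x. ennreal (M * \<tau>) \<le> f x})
      + ennreal v * (indicator {0<..<1} \<tau> * emeasure lborel {x. ennreal (N * \<tau>) \<le> g x}) \<partial>lborel)"
    by (simp add: nn_integral_add nn_integral_cmult)
  also have "\<dots> \<le> (\<integral>\<^sup>+\<tau>. indicator {0<..<1} \<tau> * emeasure lborel {x. ennreal (c * \<tau>) \<le> h x} \<partial>lborel)"
    using level by (intro nn_integral_mono) (auto simp: indicator_def)
  also have "\<dots> = (\<integral>\<^sup>+x. min 1 (ennreal (1 / c) * h x) \<partial>lborel)"
    using \<open>0 < c\<close> by (simp add: layer_cake_truncated)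
  also have "\<dots> \<le> (\<integral>\<^sup>+x. ennreal (1 / c) * h x \<partial>lborel)"
    by (intro nn_integral_mono) simp
  also have "\<dots> = ennreal (1 / c) * (\<integral>\<^sup>+x. h x \<partial>lborel)"
    by (simp add: nn_integral_cmult)
  finally have le: "ennreal (u * (a / M) + v * (b / N)) \<le> ennreal (1 / c) * (\<integral>\<^sup>+x. h x \<partial>lborel)" .
  have "a powr u * b powr v = c * ((a / M) powr u * (b / N) powr v)"
    using ab \<open>0 < M\<close> \<open>0 < N\<close> by (simp add: c_def powr_divide)
  also have "\<dots> \<le> c * (u * (a / M) + v * (b / N))"
    using ab uv \<open>0 < M\<close> \<open>0 < N\<close> \<open>0 < c\<close> by (intro mult_left_mono Youngs_inequality_0) auto
  finally have "ennreal (a powr u * b powr v) \<le> ennreal (c * (u * (a / M) + v * (b / N)))"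
    by (rule ennreal_leI)
  also have "\<dots> = ennreal c * ennreal (u * (a / M) + v * (b / N))"
    using ab uv \<open>0 < M\<close> \<open>0 < N\<close> \<open>0 < c\<close> by (simp add: ennreal_mult)
  also have "\<dots> \<le> ennreal c * (ennreal (1 / c) * (\<integral>\<^sup>+x. h x \<partial>lborel))"
    by (intro mult_left_mono le) auto
  also have "\<dots> = (\<integral>\<^sup>+x. h x \<partial>lborel)"
    using \<open>0 < c\<close> by (simp add: mult.assoc[symmetric] ennreal_mult[symmetric])
  finally show "ennreal (a powr u * b powr v) \<le> (\<integral>\<^sup>+x. h x \<partial>lborel)" .
qed

lemma ennreal_le_if_scaled_le:
  assumes "0 \<le> c" and "\<And>\<theta>::real. 0 < \<theta> \<Longrightarrow> \<theta> < 1 \<Longrightarrow> ennreal (\<theta> * c) \<le> X"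
  shows "ennreal c \<le> X"
proof (rule ccontr)
  assume "\<not> ennreal c \<le> X"
  then have X: "X < ennreal c" by simp
  then obtain x where x: "X = ennreal x" "0 \<le> x" "x < c"
    by (cases X) (auto simp: ennreal_less_iff)
  define \<theta> where "\<theta> = (x + c) / (2 * c)"
  have "0 < \<theta>" "\<theta> < 1" "x < \<theta> * c"
    using x by (auto simp: \<theta>_def field_simps)
  then show False
    using assms(2)[of \<theta>] x by (simp add: ennreal_le_iff)
qed

lemma truncation_integral_gt:
  fixes f :: "'a \<Rightarrow> ennreal"
  assumes [measurable]: "f \<in> borel_measurable M" and "w < (\<integral>\<^sup>+x. f x \<partial>M)"
  obtains k :: nat where "w < (\<integral>\<^sup>+x. min (f x) (of_nat k) \<partial>M)"
proof -
  have sup: "(SUP k. min t (of_nat k)) = t" for t :: ennreal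
  proof (cases t)
    case top
    then show ?thesis by (simp add: ennreal_SUP_of_nat_eq_top)
  next
    case (real r)
    then obtain k :: nat where "r \<le> real k" using real_arch_simple by blast
    then have "t \<le> of_nat k" using real by (simp add: ennreal_of_nat_eq_real_of_nat)
    then show ?thesis
      by (intro antisym SUP_least SUP_upper2[of k]) auto
  qed
  have "(\<integral>\<^sup>+x. f x \<partial>M) = (\<integral>\<^sup>+x. (SUP k. min (f x) (of_nat k)) \<partial>M)"
    by (simp add: sup)
  also have "\<dots> = (SUP k. \<integral>\<^sup>+x. min (f x) (of_nat k) \<partial>M)"
    by (rule nn_integral_monotone_convergence_SUP)
      (auto simp: incseq_def le_fun_def intro: min.coboundedI2)
  finally have "w < (SUP k. \<integral>\<^sup>+x. min (f x) (of_nat k) \<partial>M)"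
    using assms(2) by simp
  then show ?thesis
    unfolding less_SUP_iff using that by blast
qed

text \<open>Unbounded functions are truncated. Truncating high enough leaves an integral above
  \<open>\<theta> * a\<close> for any given \<open>\<theta> < 1\<close>, and the factor \<open>\<theta>\<close> passes through the geometric mean unchanged as \<open>u + v = 1\<close>.\<close>

lemma prekopa_leindler_real:
  fixes f g h :: "real \<Rightarrow> ennreal"
  assumes [measurable]: "f \<in> borel_measurable borel" "g \<in> borel_measurable borel"
      "h \<in> borel_measurable borel"
    and uv: "0 < u" "0 < v" "u + v = 1"
    and h: "\<And>x y. geometric_mean_le u v (f x) (g y) (h (u * x + v * y))"
  shows "geometric_mean_le u v (\<integral>\<^sup>+x. f x \<partial>lborel) (\<integral>\<^sup>+x. g x \<partial>lborel) (\<integral>\<^sup>+x. h x \<partial>lborel)"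
  unfolding geometric_mean_le_def
proof (intro allI impI)
  fix a b :: real
  assume ab: "0 < a" "0 < b" and a: "ennreal a \<le> (\<integral>\<^sup>+x. f x \<partial>lborel)"
    and b: "ennreal b \<le> (\<integral>\<^sup>+x. g x \<partial>lborel)"
  have SUP_real: "\<exists>m>0. ennreal m = (SUP x. min (F x) (of_nat k))"
    if "0 < (\<integral>\<^sup>+x. min (F x) (of_nat k) \<partial>lborel)" for F :: "real \<Rightarrow> ennreal" and k :: nat
  proof -
    have "(SUP x. min (F x) (of_nat k)) \<noteq> 0"
    proof
      assume sup: "(SUP x. min (F x) (of_nat k)) = 0"
      have "min (F x) (of_nat k) = 0" for x
        using SUP_upper[of x UNIV "\<lambda>x. min (F x) (of_nat k)"] unfolding sup by simp
      then show False using that by simp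
    qed
    moreover have "(SUP x. min (F x) (of_nat k)) \<le> of_nat k"
      by (rule SUP_least) simp
    moreover have "of_nat k < (top :: ennreal)" by (simp add: of_nat_less_top)
    ultimately obtain m where "(SUP x. min (F x) (of_nat k)) = ennreal m" "0 \<le> m" "m \<noteq> 0"
      by (cases "SUP x. min (F x) (of_nat k)") auto
    then show ?thesis by (intro exI[of _ m]) simp
  qed
  show "ennreal (a powr u * b powr v) \<le> (\<integral>\<^sup>+x. h x \<partial>lborel)"
  proof (rule ennreal_le_if_scaled_le)
    fix \<theta> :: real assume \<theta>: "0 < \<theta>" "\<theta> < 1"
    have "ennreal (\<theta> * a) < ennreal a" "ennreal (\<theta> * b) < ennreal b"
      using \<theta> ab by (simp_all add: ennreal_less_iff)
    then have "ennreal (\<theta> * a) < (\<integral>\<^sup>+x. f x \<partial>lborel)" "ennreal (\<theta> * b) < (\<integral>\<^sup>+x. g x \<partial>lborel)"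
      using a b by auto
    note lt = this
    obtain k :: nat where k: "ennreal (\<theta> * a) < (\<integral>\<^sup>+x. min (f x) (of_nat k) \<partial>lborel)"
      by (rule truncation_integral_gt[OF _ lt(1)]) auto
    obtain l :: nat where l: "ennreal (\<theta> * b) < (\<integral>\<^sup>+x. min (g x) (of_nat l) \<partial>lborel)"
      by (rule truncation_integral_gt[OF _ lt(2)]) auto
    have "0 < (\<integral>\<^sup>+x. min (f x) (of_nat k) \<partial>lborel)" "0 < (\<integral>\<^sup>+x. min (g x) (of_nat l) \<partial>lborel)"
      by (rule le_less_trans[OF zero_le k], rule le_less_trans[OF zero_le l])
    then obtain m n where mn: "0 < m" "ennreal m = (SUP x. min (f x) (of_nat k))"
      "0 < n" "ennreal n = (SUP x. min (g x) (of_nat l))"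
      using SUP_real[of f k] SUP_real[of g l] by blast
    have "geometric_mean_le u v (min (f x) (of_nat k)) (min (g y) (of_nat l)) (h (u * x + v * y))" for x y
      using h[of x y] by (auto simp: geometric_mean_le_def)
    then have "geometric_mean_le u v (\<integral>\<^sup>+x. min (f x) (of_nat k) \<partial>lborel)
        (\<integral>\<^sup>+x. min (g x) (of_nat l) \<partial>lborel) (\<integral>\<^sup>+x. h x \<partial>lborel)"
      using mn uv by (intro prekopa_leindler_real_bounded[where M=m and N=n]) auto
    then have "ennreal ((\<theta> * a) powr u * (\<theta> * b) powr v) \<le> (\<integral>\<^sup>+x. h x \<partial>lborel)"
      using k l ab \<theta> by (auto simp: geometric_mean_le_def less_imp_le)
    also have "(\<theta> * a) powr u * (\<theta> * b) powr v = \<theta> powr (u + v) * (a powr u * b powr v)"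
      using ab \<theta> by (simp add: powr_mult powr_add)
    finally show "ennreal (\<theta> * (a powr u * b powr v)) \<le> (\<integral>\<^sup>+x. h x \<partial>lborel)"
      using \<theta> uv by simp
  qed simp
qed

section \<open>The Prekopa--Leindler inequality in Euclidean space\<close>

text \<open>Induction on the set of coordinates: for fixed values of the new coordinate the induction hypothesis bounds the
  partial integrals of \<open>f\<close>, \<open>g\<close> and \<open>h\<close>, and these partial integrals satisfy the assumption of
  the inequality on the line.\<close>

lemma prekopa_leindler_PiM:
  fixes I :: "'i set" and f g h :: "('i \<Rightarrow> real) \<Rightarrow> ennreal"
  assumes "finite I" and uv: "0 < u" "0 < v" "u + v = 1"
    and "f \<in> borel_measurable (\<Pi>\<^sub>M i\<in>I. lborel)" "g \<in> borel_measurable (\<Pi>\<^sub>M i\<in>I. lborel)"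
      "h \<in> borel_measurable (\<Pi>\<^sub>M i\<in>I. lborel)"
    and "\<And>x y. x \<in> space (\<Pi>\<^sub>M i\<in>I. lborel) \<Longrightarrow> y \<in> space (\<Pi>\<^sub>M i\<in>I. lborel) \<Longrightarrow>
      geometric_mean_le u v (f x) (g y) (h (\<lambda>i\<in>I. u * x i + v * y i))"
  shows "geometric_mean_le u v (\<integral>\<^sup>+x. f x \<partial>(\<Pi>\<^sub>M i\<in>I. lborel))
    (\<integral>\<^sup>+x. g x \<partial>(\<Pi>\<^sub>M i\<in>I. lborel)) (\<integral>\<^sup>+x. h x \<partial>(\<Pi>\<^sub>M i\<in>I. lborel))"
proof -
  interpret product_sigma_finite "\<lambda>_::'i. lborel :: real measure" ..
  show ?thesis
    using assms(1,5-8)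
  proof (induction I arbitrary: f g h rule: finite_induct)
    case empty
    have "(\<lambda>i. undefined :: real) \<in> space (\<Pi>\<^sub>M i\<in>({}::'i set). lborel)"
      by (simp add: space_PiM)
    from empty(4)[OF this this] show ?case
      by (simp add: nn_integral_empty restrict_def)
  next
    case (insert i I)
    note [measurable] = insert.prems(1-3)
    have int: "(\<integral>\<^sup>+x. F x \<partial>(\<Pi>\<^sub>M j\<in>insert i I. lborel))
        = (\<integral>\<^sup>+t. \<integral>\<^sup>+x. F (x(i := t)) \<partial>(\<Pi>\<^sub>M j\<in>I. lborel) \<partial>lborel)"
      if "F \<in> borel_measurable (\<Pi>\<^sub>M j\<in>insert i I. lborel)" for F :: "('i \<Rightarrow> real) \<Rightarrow> ennreal"
      using insert.hyps that by (rule product_nn_integral_insert_rev)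
    have meas: "(\<lambda>t. \<integral>\<^sup>+x. F (x(i := t)) \<partial>(\<Pi>\<^sub>M j\<in>I. lborel)) \<in> borel_measurable borel"
      if [measurable]: "F \<in> borel_measurable (\<Pi>\<^sub>M j\<in>insert i I. lborel)" for F :: "('i \<Rightarrow> real) \<Rightarrow> ennreal"
    proof -
      interpret I: sigma_finite_measure "\<Pi>\<^sub>M j\<in>I. lborel :: real measure"
        using insert.hyps(1) by (rule sigma_finite)
      show ?thesis by measurable
    qed
    show ?case
      unfolding int[OF insert.prems(1)] int[OF insert.prems(2)] int[OF insert.prems(3)]
    proof (rule prekopa_leindler_real[OF _ _ _ uv])
      fix s t :: real
      show "geometric_mean_le u v (\<integral>\<^sup>+x. f (x(i := s)) \<partial>(\<Pi>\<^sub>M j\<in>I. lborel))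
        (\<integral>\<^sup>+x. g (x(i := t)) \<partial>(\<Pi>\<^sub>M j\<in>I. lborel))
        (\<integral>\<^sup>+x. h (x(i := u * s + v * t)) \<partial>(\<Pi>\<^sub>M j\<in>I. lborel))"
      proof (rule insert.IH)
        fix x y assume xy: "x \<in> space (\<Pi>\<^sub>M j\<in>I. lborel :: real measure)"
          "y \<in> space (\<Pi>\<^sub>M j\<in>I. lborel :: real measure)"
        have eq: "(\<lambda>j\<in>insert i I. u * (x(i := s)) j + v * (y(i := t)) j)
          = (\<lambda>j\<in>I. u * x j + v * y j)(i := u * s + v * t)"
          using insert.hyps by (auto simp: fun_eq_iff restrict_def)
        have "x(i := s) \<in> space (\<Pi>\<^sub>M j\<in>insert i I. lborel)"
          "y(i := t) \<in> space (\<Pi>\<^sub>M j\<in>insert i I. lborel)"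
          using xy by (auto simp: space_PiM PiE_def extensional_def)
        then show "geometric_mean_le u v (f (x(i := s))) (g (y(i := t)))
          (h ((\<lambda>j\<in>I. u * x j + v * y j)(i := u * s + v * t)))"
          unfolding eq[symmetric] by (rule insert.prems(4))
      qed measurable
    qed (intro meas insert.prems)+
  qed
qed

theorem prekopa_leindler:
  fixes f g h :: "'a::euclidean_space \<Rightarrow> ennreal"
  assumes [measurable]: "f \<in> borel_measurable borel" "g \<in> borel_measurable borel"
      "h \<in> borel_measurable borel"
    and uv: "0 < u" "0 < v" "u + v = 1"
    and h: "\<And>x y. geometric_mean_le u v (f x) (g y) (h (u *\<^sub>R x + v *\<^sub>R y))"
  shows "geometric_mean_le u v (\<integral>\<^sup>+x. f x \<partial>lborel) (\<integral>\<^sup>+x. g x \<partial>lborel) (\<integral>\<^sup>+x. h x \<partial>lborel)"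
proof -
  let ?P = "\<Pi>\<^sub>M b\<in>(Basis::'a set). lborel :: real measure"
  define T :: "('a \<Rightarrow> real) \<Rightarrow> 'a" where "T x = (\<Sum>b\<in>Basis. x b *\<^sub>R b)" for x
  have [measurable]: "T \<in> borel_measurable ?P"
    unfolding T_def by measurable
  have T: "(\<integral>\<^sup>+x. F x \<partial>lborel) = (\<integral>\<^sup>+x. F (T x) \<partial>?P)"
    if "F \<in> borel_measurable borel" for F :: "'a \<Rightarrow> ennreal"
    using that by (subst lborel_eq) (simp add: nn_integral_distr T_def[symmetric])
  have add: "T (\<lambda>b\<in>Basis. u * x b + v * y b) = u *\<^sub>R T x + v *\<^sub>R T y" for x y
    by (simp add: T_def scaleR_sum_right sum.distrib[symmetric] scaleR_add_left)
  show ?thesis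
    unfolding T[OF assms(1)] T[OF assms(2)] T[OF assms(3)]
    using h by (intro prekopa_leindler_PiM uv) (auto simp: add)
qed

section \<open>The Borell--Brascamp--Lieb inequality for Borel functions\<close>

lemma nn_integral_lborel_affine:
  fixes F :: "'a::euclidean_space \<Rightarrow> ennreal"
  assumes [measurable]: "F \<in> borel_measurable borel" and "0 < c"
  shows "(\<integral>\<^sup>+x. F x \<partial>lborel) = ennreal (c ^ DIM('a)) * (\<integral>\<^sup>+x. F (t + c *\<^sub>R x) \<partial>lborel)"
  using \<open>0 < c\<close> by (subst lborel_affine[where c=c and t=t])
    (simp_all add: nn_integral_density nn_integral_distr nn_integral_cmult)

lemma nn_integral_rescaled:
  fixes F :: "'a::euclidean_space \<Rightarrow> ennreal"
  assumes [measurable]: "F \<in> borel_measurable borel" and "0 < c"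
  shows "(\<integral>\<^sup>+x. F x \<partial>lborel)
    = ennreal (c powr (real DIM('a) + s)) * (\<integral>\<^sup>+x. ennreal (c powr - s) * F (c *\<^sub>R x) \<partial>lborel)"
proof -
  have "c powr (real DIM('a) + s) * c powr - s = c ^ DIM('a)"
    using \<open>0 < c\<close> by (simp add: powr_add[symmetric] powr_realpow)
  then have "ennreal (c ^ DIM('a)) = ennreal (c powr (real DIM('a) + s)) * ennreal (c powr - s)"
    by (simp add: ennreal_mult[symmetric])
  then show ?thesis
    using nn_integral_lborel_affine[OF assms, of 0]
    by (simp add: nn_integral_cmult mult.assoc)
qed

text \<open>The exponent \<open>1 / d\<close> appears because stretching a function by \<open>c\<close> in its argument and by
  \<open>c powr s\<close> in its value multiplies its integral by \<open>c powr d\<close>. Rescaling by \<open>\<alpha>\<close> and \<open>\<beta>\<close> brings the integrals of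
  \<open>f\<close> and \<open>g\<close> to at least \<open>1\<close>, and rescaling \<open>h\<close> by \<open>m = a \<alpha> + b \<beta>\<close> turns the coefficients into the
  convex weights \<open>u\<close> and \<open>v\<close>. The power mean in the assumption dominates the geometric mean, so the
  Prekopa--Leindler inequality bounds the integral of the rescaled \<open>h\<close> from below by \<open>1\<close>; undoing the
  scaling produces the factor \<open>m powr d\<close>.\<close>

theorem borell_brascamp_lieb_borel:
  fixes f g h :: "'a::euclidean_space \<Rightarrow> ennreal" and a b s A B :: real
  defines "d \<equiv> real DIM('a) + s"
  assumes [measurable]: "f \<in> borel_measurable borel" "g \<in> borel_measurable borel"
      "h \<in> borel_measurable borel"
    and pos: "0 < a" "0 < b" "0 < s"
    and h: "\<And>x y p q. 0 < p \<Longrightarrow> 0 < q \<Longrightarrow> ennreal p \<le> f x \<Longrightarrow> ennreal q \<le> g y \<Longrightarrow>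
      ennreal ((a * p powr (1 / s) + b * q powr (1 / s)) powr s) \<le> h (a *\<^sub>R x + b *\<^sub>R y)"
    and AB: "0 < A" "0 < B"
    and A: "ennreal A \<le> (\<integral>\<^sup>+x. f x \<partial>lborel)" and B: "ennreal B \<le> (\<integral>\<^sup>+x. g x \<partial>lborel)"
  shows "ennreal ((a * A powr (1 / d) + b * B powr (1 / d)) powr d) \<le> (\<integral>\<^sup>+x. h x \<partial>lborel)"
proof -
  have "0 < d" using \<open>0 < s\<close> by (simp add: d_def)
  define \<alpha> \<beta> where "\<alpha> = A powr (1 / d)" and "\<beta> = B powr (1 / d)"
  have ab: "0 < \<alpha>" "0 < \<beta>" "\<alpha> powr d = A" "\<beta> powr d = B"
    using AB \<open>0 < d\<close> by (simp_all add: \<alpha>_def \<beta>_def powr_powr)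
  define m where "m = a * \<alpha> + b * \<beta>"
  have "0 < m" using ab pos by (simp add: m_def add_pos_pos)
  define u v where "u = a * \<alpha> / m" and "v = b * \<beta> / m"
  have uv: "0 < u" "0 < v" "u + v = 1"
    using ab pos \<open>0 < m\<close> by (simp_all add: u_def v_def add_divide_distrib[symmetric] m_def[symmetric])
  have mu: "m * u = a * \<alpha>" "m * v = b * \<beta>"
    using \<open>0 < m\<close> by (simp_all add: u_def v_def)
  define resc where "resc c F x = ennreal (c powr - s) * F (c *\<^sub>R x)"
    for c :: real and F :: "'a \<Rightarrow> ennreal" and x
  have [measurable]: "resc c F \<in> borel_measurable borel" if [measurable]: "F \<in> borel_measurable borel" for c F
    unfolding resc_def by measurable
  have int: "(\<integral>\<^sup>+x. F x \<partial>lborel) = ennreal (c powr d) * (\<integral>\<^sup>+x. resc c F x \<partial>lborel)"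
    if "0 < c" "F \<in> borel_measurable borel" for c F
    using nn_integral_rescaled[OF that(2,1), of s] by (simp add: resc_def d_def)
  have resc_le: "ennreal p \<le> resc c F x \<longleftrightarrow> ennreal (c powr s * p) \<le> F (c *\<^sub>R x)" if "0 < c" "0 < p" for c p F x
  proof -
    have *: "ennreal (c powr s) * ennreal (c powr - s) = 1"
      using that by (simp add: ennreal_mult[symmetric] powr_add[symmetric])
    then have **: "ennreal (c powr - s) * ennreal (c powr s) = 1"
      by (simp only: mult.commute)
    show ?thesis
    proof
      assume "ennreal p \<le> resc c F x"
      then have "ennreal (c powr s) * ennreal p \<le> ennreal (c powr s) * (ennreal (c powr - s) * F (c *\<^sub>R x))"
        unfolding resc_def by (rule mult_left_mono) simp
      then show "ennreal (c powr s * p) \<le> F (c *\<^sub>R x)"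
        using that by (simp add: ennreal_mult mult.assoc[symmetric] *)
    next
      assume "ennreal (c powr s * p) \<le> F (c *\<^sub>R x)"
      then have "ennreal (c powr - s) * (ennreal (c powr s) * ennreal p) \<le> resc c F x"
        using that unfolding resc_def by (intro mult_left_mono) (simp_all add: ennreal_mult)
      then show "ennreal p \<le> resc c F x"
        by (simp add: mult.assoc[symmetric] **)
    qed
  qed
  have "geometric_mean_le u v (resc \<alpha> f x) (resc \<beta> g y) (resc m h (u *\<^sub>R x + v *\<^sub>R y))" for x y
    unfolding geometric_mean_le_def
  proof (intro allI impI)
    fix p q :: real
    assume pq: "0 < p" "0 < q" and "ennreal p \<le> resc \<alpha> f x" "ennreal q \<le> resc \<beta> g y"
    then have "ennreal (\<alpha> powr s * p) \<le> f (\<alpha> *\<^sub>R x)" "ennreal (\<beta> powr s * q) \<le> g (\<beta> *\<^sub>R y)"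
      using resc_le ab by auto
    then have "ennreal ((a * (\<alpha> powr s * p) powr (1 / s) + b * (\<beta> powr s * q) powr (1 / s)) powr s)
      \<le> h (a *\<^sub>R \<alpha> *\<^sub>R x + b *\<^sub>R \<beta> *\<^sub>R y)"
      using pq ab by (intro h) auto
    also have "a *\<^sub>R \<alpha> *\<^sub>R x + b *\<^sub>R \<beta> *\<^sub>R y = m *\<^sub>R (u *\<^sub>R x + v *\<^sub>R y)"
      by (simp add: scaleR_add_right mu)
    also have "a * (\<alpha> powr s * p) powr (1 / s) + b * (\<beta> powr s * q) powr (1 / s)
      = m * (u * p powr (1 / s) + v * q powr (1 / s))"
      using pos ab pq by (simp add: powr_mult powr_powr distrib_left mult.assoc[symmetric] mu)
    finally have le: "ennreal ((m * (u * p powr (1 / s) + v * q powr (1 / s))) powr s)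
      \<le> h (m *\<^sub>R (u *\<^sub>R x + v *\<^sub>R y))" .
    have "m powr s * (p powr u * q powr v)
      = m powr s * ((p powr (1 / s)) powr u * (q powr (1 / s)) powr v) powr s"
      using pos pq by (simp add: powr_mult powr_powr)
    also have "\<dots> \<le> m powr s * (u * p powr (1 / s) + v * q powr (1 / s)) powr s"
      using pos pq uv by (intro mult_left_mono powr_mono2 Youngs_inequality_0) auto
    also have "\<dots> = (m * (u * p powr (1 / s) + v * q powr (1 / s))) powr s"
      using uv \<open>0 < m\<close> by (simp add: powr_mult)
    finally have "ennreal (m powr s * (p powr u * q powr v)) \<le> h (m *\<^sub>R (u *\<^sub>R x + v *\<^sub>R y))"
      using le by (meson ennreal_leI order_trans)
    then show "ennreal (p powr u * q powr v) \<le> resc m h (u *\<^sub>R x + v *\<^sub>R y)"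
      using resc_le \<open>0 < m\<close> pq by simp
  qed
  then have pl: "geometric_mean_le u v (\<integral>\<^sup>+x. resc \<alpha> f x \<partial>lborel) (\<integral>\<^sup>+x. resc \<beta> g x \<partial>lborel)
      (\<integral>\<^sup>+x. resc m h x \<partial>lborel)"
    by (intro prekopa_leindler uv) auto
  have one: "ennreal 1 \<le> (\<integral>\<^sup>+x. resc c F x \<partial>lborel)"
    if "0 < c" "F \<in> borel_measurable borel" "ennreal (c powr d) \<le> (\<integral>\<^sup>+x. F x \<partial>lborel)" for c F
  proof -
    have "ennreal (c powr - d) * ennreal (c powr d)
      \<le> ennreal (c powr - d) * (ennreal (c powr d) * (\<integral>\<^sup>+x. resc c F x \<partial>lborel))"
      using that(3) unfolding int[OF that(1,2)] by (rule mult_left_mono) simp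
    moreover have "ennreal (c powr - d) * ennreal (c powr d) = 1"
      using that by (simp add: ennreal_mult[symmetric] powr_add[symmetric])
    ultimately show ?thesis by (simp add: mult.assoc[symmetric])
  qed
  have "ennreal 1 \<le> (\<integral>\<^sup>+x. resc \<alpha> f x \<partial>lborel)" "ennreal 1 \<le> (\<integral>\<^sup>+x. resc \<beta> g x \<partial>lborel)"
    using ab A B by (simp_all only: one assms(2,3))
  then have "ennreal (1 powr u * 1 powr v) \<le> (\<integral>\<^sup>+x. resc m h x \<partial>lborel)"
    using pl[unfolded geometric_mean_le_def, rule_format, OF zero_less_one zero_less_one] by blast
  then have "ennreal (m powr d) * 1 \<le> ennreal (m powr d) * (\<integral>\<^sup>+x. resc m h x \<partial>lborel)"
    by (intro mult_left_mono) auto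
  then show ?thesis
    unfolding int[OF \<open>0 < m\<close> assms(4), symmetric] by (simp add: m_def \<alpha>_def \<beta>_def)
qed

section \<open>From Borel to Lebesgue measurable functions\<close>

text \<open>A Lebesgue measurable function is changed to the constant \<open>c\<close> on a Borel null set outside of which it
  agrees with a Borel function. Taking \<open>c = 0\<close> yields a Borel minorant, and \<open>c = \<infinity>\<close> a Borel
  majorant, with the same integral. Pointwise assumptions that bound \<open>h\<close> from below by \<open>f\<close> and \<open>g\<close>
  thus survive at every point if \<open>f\<close> and \<open>g\<close> are replaced by minorants and \<open>h\<close> by a majorant.\<close>

lemma lebesgue_borel_modification:
  fixes f :: "'a::euclidean_space \<Rightarrow> ennreal"
  assumes "f \<in> borel_measurable lebesgue"
  obtains f' where "f' \<in> borel_measurable borel" "\<And>x. f' x = f x \<or> f' x = c"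
    "(\<integral>\<^sup>+x. f' x \<partial>lborel) = (\<integral>\<^sup>+x. f x \<partial>lebesgue)"
proof -
  obtain f' where [measurable]: "f' \<in> borel_measurable lborel" and ae: "AE x in lborel. f x = f' x"
    using completion_ex_borel_measurable[OF assms] by blast
  obtain N where N: "N \<in> null_sets lborel" "{x \<in> space lborel. f x \<noteq> f' x} \<subseteq> N"
    using AE_E[OF ae] by (metis null_setsI)
  then have eq: "f x = f' x" if "x \<notin> N" for x using that by auto
  have [measurable]: "N \<in> sets borel" using N(1) by auto
  show ?thesis
  proof
    show "(\<lambda>x. if x \<in> N then c else f' x) \<in> borel_measurable borel" by measurable
    show "(\<integral>\<^sup>+x. (if x \<in> N then c else f' x) \<partial>lborel) = (\<integral>\<^sup>+x. f x \<partial>lebesgue)"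
      unfolding nn_integral_completion using ae AE_not_in[OF N(1)] by (intro nn_integral_cong_AE) auto
  qed (use eq in auto)
qed

lemma integrable_lebesgue_borel_modification:
  fixes f :: "'a::euclidean_space \<Rightarrow> real"
  assumes "integrable lebesgue f" "\<And>x. 0 \<le> f x"
  obtains f' where "f' \<in> borel_measurable borel" "\<And>x. f' x = ennreal (f x) \<or> f' x = c"
    "(\<integral>\<^sup>+x. f' x \<partial>lborel) = ennreal (\<integral>x. f x \<partial>lebesgue)"
proof -
  have "(\<lambda>x. ennreal (f x)) \<in> borel_measurable lebesgue"
    using assms(1) by simp
  then obtain f' where "f' \<in> borel_measurable borel" "\<And>x. f' x = ennreal (f x) \<or> f' x = c"
    "(\<integral>\<^sup>+x. f' x \<partial>lborel) = (\<integral>\<^sup>+x. ennreal (f x) \<partial>lebesgue)"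
    by (rule lebesgue_borel_modification[where c=c]) (rule that)
  then show ?thesis
    using that nn_integral_eq_integral[OF assms(1)] assms(2) by simp
qed

theorem borell_brascamp_lieb:
  fixes f g h :: "'a::euclidean_space \<Rightarrow> real" and a b s :: real
  defines "d \<equiv> real DIM('a) + s"
  assumes int: "integrable lebesgue f" "integrable lebesgue g" "integrable lebesgue h"
    and nonneg: "\<And>x. 0 \<le> f x" "\<And>x. 0 \<le> g x" "\<And>x. 0 \<le> h x"
    and pos: "0 < a" "0 < b" "0 < s"
    and h: "\<And>x y. 0 < f x \<Longrightarrow> 0 < g y \<Longrightarrow>
      a * f x powr (1 / s) + b * g y powr (1 / s) \<le> h (a *\<^sub>R x + b *\<^sub>R y) powr (1 / s)"
    and int_pos: "0 < (\<integral>x. f x \<partial>lebesgue)" "0 < (\<integral>x. g x \<partial>lebesgue)"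
  shows "a * (\<integral>x. f x \<partial>lebesgue) powr (1 / d) + b * (\<integral>x. g x \<partial>lebesgue) powr (1 / d)
    \<le> (\<integral>x. h x \<partial>lebesgue) powr (1 / d)"
proof -
  obtain f' where f': "f' \<in> borel_measurable borel" "\<And>x. f' x = ennreal (f x) \<or> f' x = 0"
    "(\<integral>\<^sup>+x. f' x \<partial>lborel) = ennreal (\<integral>x. f x \<partial>lebesgue)"
    by (rule integrable_lebesgue_borel_modification[OF int(1) nonneg(1), where c=0]) (rule that)
  obtain g' where g': "g' \<in> borel_measurable borel" "\<And>x. g' x = ennreal (g x) \<or> g' x = 0"
    "(\<integral>\<^sup>+x. g' x \<partial>lborel) = ennreal (\<integral>x. g x \<partial>lebesgue)"
    by (rule integrable_lebesgue_borel_modification[OF int(2) nonneg(2), where c=0]) (rule that)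
  obtain h' where h': "h' \<in> borel_measurable borel" "\<And>x. h' x = ennreal (h x) \<or> h' x = top"
    "(\<integral>\<^sup>+x. h' x \<partial>lborel) = ennreal (\<integral>x. h x \<partial>lebesgue)"
    by (rule integrable_lebesgue_borel_modification[OF int(3) nonneg(3), where c=top]) (rule that)
  have "0 < d" using \<open>0 < s\<close> by (simp add: d_def)
  let ?F = "\<integral>x. f x \<partial>lebesgue" and ?G = "\<integral>x. g x \<partial>lebesgue"
  have "ennreal ((a * ?F powr (1 / d) + b * ?G powr (1 / d)) powr d) \<le> (\<integral>\<^sup>+x. h' x \<partial>lborel)"
    unfolding d_def
  proof (rule borell_brascamp_lieb_borel[where f=f' and g=g'])
    fix x y p q
    assume pq: "0 < p" "0 < q" and p: "ennreal p \<le> f' x" and q: "ennreal q \<le> g' y"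
    have "p \<le> f x"
      using f'(2)[of x] p pq nonneg(1)[of x] by (auto simp: ennreal_le_iff)
    moreover have "q \<le> g y"
      using g'(2)[of y] q pq nonneg(2)[of y] by (auto simp: ennreal_le_iff)
    ultimately have "a * p powr (1 / s) + b * q powr (1 / s)
        \<le> a * f x powr (1 / s) + b * g y powr (1 / s)"
      using pos pq by (intro add_mono mult_left_mono powr_mono2) auto
    also have "\<dots> \<le> h (a *\<^sub>R x + b *\<^sub>R y) powr (1 / s)"
      using \<open>p \<le> f x\<close> \<open>q \<le> g y\<close> pq by (intro h) auto
    finally have "(a * p powr (1 / s) + b * q powr (1 / s)) powr s
        \<le> (h (a *\<^sub>R x + b *\<^sub>R y) powr (1 / s)) powr s"
      using pos by (intro powr_mono2) auto
    also have "\<dots> = h (a *\<^sub>R x + b *\<^sub>R y)"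
      using pos nonneg(3) by (simp add: powr_powr)
    finally have "ennreal ((a * p powr (1 / s) + b * q powr (1 / s)) powr s)
        \<le> ennreal (h (a *\<^sub>R x + b *\<^sub>R y))"
      by (rule ennreal_leI)
    then show "ennreal ((a * p powr (1 / s) + b * q powr (1 / s)) powr s) \<le> h' (a *\<^sub>R x + b *\<^sub>R y)"
      using h'(2)[of "a *\<^sub>R x + b *\<^sub>R y"] by auto
  qed (use f' g' h' pos int_pos in auto)
  then have "(a * ?F powr (1 / d) + b * ?G powr (1 / d)) powr d \<le> (\<integral>x. h x \<partial>lebesgue)"
    unfolding h'(3) using nonneg(3) by (subst (asm) ennreal_le_iff) auto
  then have "((a * ?F powr (1 / d) + b * ?G powr (1 / d)) powr d) powr (1 / d)
      \<le> (\<integral>x. h x \<partial>lebesgue) powr (1 / d)"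
    using \<open>0 < d\<close> by (intro powr_mono2) auto
  then show ?thesis
    using \<open>0 < d\<close> pos by (simp add: powr_powr)
qed

text \<open>A substitute for the Borell--Brascamp--Lieb inequality when one of the two integrals vanishes: the
  argument belonging to that function is kept at a single point, which only contributes the
  translation \<open>t\<close>.\<close>

lemma integral_powr_le_of_affine_dominated:
  fixes f h :: "'a::euclidean_space \<Rightarrow> real" and b s :: real
  defines "d \<equiv> real DIM('a) + s"
  assumes int: "integrable lebesgue f" "integrable lebesgue h"
    and nonneg: "\<And>x. 0 \<le> f x" "\<And>x. 0 \<le> h x"
    and pos: "0 < b" "0 < s"
    and h: "\<And>y. 0 < f y \<Longrightarrow> b * f y powr (1 / s) \<le> h (t + b *\<^sub>R y) powr (1 / s)"
  shows "b * (\<integral>x. f x \<partial>lebesgue) powr (1 / d) \<le> (\<integral>x. h x \<partial>lebesgue) powr (1 / d)"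
proof -
  obtain f' where f': "f' \<in> borel_measurable borel" "\<And>x. f' x = ennreal (f x) \<or> f' x = 0"
    "(\<integral>\<^sup>+x. f' x \<partial>lborel) = ennreal (\<integral>x. f x \<partial>lebesgue)"
    by (rule integrable_lebesgue_borel_modification[OF int(1) nonneg(1), where c=0]) (rule that)
  obtain h' where h': "h' \<in> borel_measurable borel" "\<And>x. h' x = ennreal (h x) \<or> h' x = top"
    "(\<integral>\<^sup>+x. h' x \<partial>lborel) = ennreal (\<integral>x. h x \<partial>lebesgue)"
    by (rule integrable_lebesgue_borel_modification[OF int(2) nonneg(2), where c=top]) (rule that)
  have "0 < d" using \<open>0 < s\<close> by (simp add: d_def)
  let ?F = "\<integral>x. f x \<partial>lebesgue"
  have le: "b powr s * f y \<le> h (t + b *\<^sub>R y)" for y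
  proof (cases "0 < f y")
    case True
    have "b powr s * f y = (b * f y powr (1 / s)) powr s"
      using pos True by (simp add: powr_mult powr_powr)
    also have "\<dots> \<le> (h (t + b *\<^sub>R y) powr (1 / s)) powr s"
      using pos True by (intro powr_mono2 h) auto
    also have "\<dots> = h (t + b *\<^sub>R y)"
      using pos nonneg by (simp add: powr_powr)
    finally show ?thesis .
  next
    case False
    then show ?thesis using nonneg(1)[of y] nonneg(2) by (simp add: order.antisym)
  qed
  have le': "ennreal (b powr s) * f' y \<le> h' (t + b *\<^sub>R y)" for y
    using f'(2)[of y] h'(2)[of "t + b *\<^sub>R y"] ennreal_leI[OF le[of y]] nonneg(1)[of y]
    by (auto simp: ennreal_mult)
  have "ennreal (b powr d * ?F) = ennreal (b ^ DIM('a)) * (ennreal (b powr s) * ennreal ?F)"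
    using pos nonneg by (simp add: d_def powr_add powr_realpow ennreal_mult mult.assoc)
  also have "\<dots> = ennreal (b ^ DIM('a)) * (\<integral>\<^sup>+x. ennreal (b powr s) * f' x \<partial>lborel)"
    using f' by (simp add: nn_integral_cmult)
  also have "\<dots> \<le> ennreal (b ^ DIM('a)) * (\<integral>\<^sup>+x. h' (t + b *\<^sub>R x) \<partial>lborel)"
    by (intro mult_left_mono nn_integral_mono le') auto
  also have "\<dots> = ennreal (\<integral>x. h x \<partial>lebesgue)"
    using nn_integral_lborel_affine[OF h'(1) pos(1)] h'(3) by simp
  finally have "b powr d * ?F \<le> (\<integral>x. h x \<partial>lebesgue)"
    using nonneg(2) by (subst (asm) ennreal_le_iff) auto
  then have "(b powr d * ?F) powr (1 / d) \<le> (\<integral>x. h x \<partial>lebesgue) powr (1 / d)"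
    using \<open>0 < d\<close> nonneg by (intro powr_mono2) auto
  then show ?thesis
    using \<open>0 < d\<close> pos nonneg by (simp add: powr_mult powr_powr)
qed

section \<open>Optimising the weight\<close>

lemma real_of_ereal_inverse_conjugate:
  assumes "1 \<le> p" "holder_conjugate p q"
  shows "real_of_ereal (1 / q) = 1 - 1 / p"
proof (cases q)
  case (real r)
  then have r: "1 \<le> r" and "1 / ereal p + 1 / ereal r = 1"
    using assms by (auto simp: holder_conjugate_def)
  then have "ereal (1 / p + 1 / r) = ereal 1"
    using assms(1) by (simp add: one_ereal_def)
  then show ?thesis using real r by (simp add: one_ereal_def)
next
  case PInf
  then have "1 / ereal p = 1" using assms by (auto simp: holder_conjugate_def)
  then have "ereal (1 / p) = ereal 1" using assms(1) by (simp add: one_ereal_def)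
  then show ?thesis using PInf by simp
next
  case MInf
  then show ?thesis using assms by (simp add: holder_conjugate_def)
qed

text \<open>By Hoelder's inequality the right side is the maximum over \<open>t\<close> of the left side; it is attained where
  \<open>1 - t\<close> and \<open>t\<close> are proportional to \<open>X powr p\<close> and \<open>Y powr p\<close>.\<close>

lemma holder_equality_weight:
  fixes p X Y :: real
  assumes "1 \<le> p" "0 < X" "0 < Y"
  obtains t where "0 < t" "t < 1"
    "rpow (1 - t) (1 - 1 / p) * X + rpow t (1 - 1 / p) * Y = (X powr p + Y powr p) powr (1 / p)"
proof
  define S where "S = X powr p + Y powr p"
  have S: "0 < S" using assms by (simp add: S_def add_pos_pos)
  define t where "t = Y powr p / S"
  have t1: "1 - t = X powr p / S"
    using S by (simp add: t_def field_simps) (simp add: S_def)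
  show "0 < t" using S assms by (simp add: t_def)
  have "0 < 1 - t" unfolding t1 using S assms by simp
  then show "t < 1" by simp
  have *: "rpow (Z powr p / S) (1 - 1 / p) * Z = Z powr p / S powr (1 - 1 / p)" if "0 < Z" for Z
  proof -
    have "rpow (Z powr p / S) (1 - 1 / p) = (Z powr p / S) powr (1 - 1 / p)"
      using that S by (simp add: rpow_def)
    also have "\<dots> = Z powr (p - 1) / S powr (1 - 1 / p)"
      using that S assms by (simp add: powr_divide powr_powr right_diff_distrib)
    finally show ?thesis
      using that by (simp add: powr_diff)
  qed
  have "rpow (1 - t) (1 - 1 / p) * X + rpow t (1 - 1 / p) * Y = S / S powr (1 - 1 / p)"
    unfolding t1 unfolding t_def *[OF assms(2)] *[OF assms(3)]
    by (simp add: add_divide_distrib[symmetric] S_def)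
  also have "\<dots> = S powr (1 / p)"
    using S by (simp add: powr_diff)
  finally show "rpow (1 - t) (1 - 1 / p) * X + rpow t (1 - 1 / p) * Y = (X powr p + Y powr p) powr (1 / p)"
    unfolding S_def .
qed

theorem theorem1p5:
  fixes f g h :: "real ^ 'n \<Rightarrow> real"
    and p s \<mu> \<omega> :: real
    and q :: ereal
  assumes "p \<ge> 1" and "s > 0" and "\<mu> > 0" and "\<omega> > 0"
    and "holder_conjugate p q"
    and "\<And>x. f x \<ge> 0" and "\<And>x. g x \<ge> 0" and "\<And>x. h x \<ge> 0"
    and "integrable lebesgue f" and "integrable lebesgue g" and "integrable lebesgue h"
    and "supp f \<noteq> {}" and "supp g \<noteq> {}" and "supp h \<noteq> {}"
    and "\<And>x y t. x \<in> supp f \<Longrightarrow> y \<in> supp g \<Longrightarrow> t \<in> {0..1} \<Longrightarrow>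
      h ((rpow (1 - t) (real_of_ereal (1 / q)) * \<mu> powr (1 / p)) *\<^sub>R x
          + (rpow t (real_of_ereal (1 / q)) * \<omega> powr (1 / p)) *\<^sub>R y) powr (1 / s)
      \<ge> rpow (1 - t) (real_of_ereal (1 / q)) * \<mu> powr (1 / p) * f x powr (1 / s)
          + rpow t (real_of_ereal (1 / q)) * \<omega> powr (1 / p) * g y powr (1 / s)"
  shows "(\<integral>x. h x \<partial>lebesgue) powr (p / (real CARD('n) + s))
      \<ge> \<mu> * (\<integral>x. f x \<partial>lebesgue) powr (p / (real CARD('n) + s))
        + \<omega> * (\<integral>x. g x \<partial>lebesgue) powr (p / (real CARD('n) + s))"
proof -
  note pos = \<open>p \<ge> 1\<close> \<open>s > 0\<close> \<open>\<mu> > 0\<close> \<open>\<omega> > 0\<close>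
  note nonneg = assms(6-8) and int = assms(9-11)
  define d where "d = real CARD('n) + s"
  define r where "r = 1 - 1 / p"
  define \<mu>' \<omega>' where "\<mu>' = \<mu> powr (1 / p)" and "\<omega>' = \<omega> powr (1 / p)"
  define F G H where "F = (\<integral>x. f x \<partial>lebesgue)" and "G = (\<integral>x. g x \<partial>lebesgue)"
    and "H = (\<integral>x. h x \<partial>lebesgue)"
  have FGH: "0 \<le> F" "0 \<le> G" "0 \<le> H"
    using nonneg by (simp_all add: F_def G_def H_def)
  have "0 < d" using pos by (simp add: d_def add_nonneg_pos)
  have mu: "0 < \<mu>'" "0 < \<omega>'" "\<mu>' powr p = \<mu>" "\<omega>' powr p = \<omega>"
    using pos by (simp_all add: \<mu>'_def \<omega>'_def powr_powr)
  have q: "real_of_ereal (1 / q) = r"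
    unfolding r_def using assms(1,5) by (rule real_of_ereal_inverse_conjugate)
  have hyp: "rpow (1 - t) r * \<mu>' * f x powr (1 / s) + rpow t r * \<omega>' * g y powr (1 / s)
    \<le> h ((rpow (1 - t) r * \<mu>') *\<^sub>R x + (rpow t r * \<omega>') *\<^sub>R y) powr (1 / s)"
    if "x \<in> supp f" "y \<in> supp g" "0 \<le> t" "t \<le> 1" for x y t
    using assms(15)[of x y t] that by (simp add: q \<mu>'_def \<omega>'_def)
  have pos_supp: "x \<in> supp k" if "0 < k x" for k :: "real ^ 'n \<Rightarrow> real" and x
    using that closure_subset[of "{x. 0 < k x}"] by (auto simp: supp_def)
  note supp_f = pos_supp[of f] and supp_g = pos_supp[of g]
  have rpow_nonneg: "0 \<le> rpow t r" for t by (simp add: rpow_def)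
  have rpow_1: "rpow 1 r = 1" by (simp add: rpow_def)
  have root: "(c * E powr (1 / d)) powr p = c powr p * E powr (p / d)" if "0 \<le> c" "0 \<le> E" for c E
    using that by (simp add: powr_mult powr_powr)
  have H_powr: "H powr (p / d) = (H powr (1 / d)) powr p"
    using FGH by (simp add: powr_powr)
  have "\<mu> * F powr (p / d) + \<omega> * G powr (p / d) \<le> H powr (p / d)"
  proof -
    \<comment> \<open>If an integral vanishes, an endpoint \<open>t = 1\<close> or \<open>t = 0\<close> is used. The weight \<open>rpow 0 r\<close> of
      the other function is \<open>1\<close> rather than \<open>0\<close> for \<open>p = 1\<close>, so its argument still shifts \<open>h\<close>.\<close>
    consider "F = 0" | "G = 0" | "0 < F" "0 < G" using FGH by fastforce
    then show ?thesis
    proof cases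
      case 1
      obtain x where x: "x \<in> supp f" using assms(12) by blast
      have "\<omega>' * G powr (1 / d) \<le> H powr (1 / d)"
      proof -
        have "\<omega>' * g y powr (1 / s) \<le> h ((rpow 0 r * \<mu>') *\<^sub>R x + \<omega>' *\<^sub>R y) powr (1 / s)"
          if "0 < g y" for y
        proof -
          have "0 \<le> rpow 0 r * \<mu>' * f x powr (1 / s)"
            using rpow_nonneg mu by simp
          then show ?thesis
            using hyp[OF x supp_g[OF that], of 1] by (simp add: rpow_1)
        qed
        then show ?thesis
          using integral_powr_le_of_affine_dominated[where t="(rpow 0 r * \<mu>') *\<^sub>R x", OF int(2,3) nonneg(2,3) mu(2) \<open>0 < s\<close>]
          by (simp add: G_def H_def d_def)
      qed
      then have "(\<omega>' * G powr (1 / d)) powr p \<le> (H powr (1 / d)) powr p"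
        using pos mu by (intro powr_mono2) auto
      then show ?thesis
        using 1 mu FGH \<open>0 < d\<close> by (simp add: root H_powr)
    next
      case 2
      obtain y where y: "y \<in> supp g" using assms(13) by blast
      have "\<mu>' * F powr (1 / d) \<le> H powr (1 / d)"
      proof -
        have "\<mu>' * f x powr (1 / s) \<le> h ((rpow 0 r * \<omega>') *\<^sub>R y + \<mu>' *\<^sub>R x) powr (1 / s)"
          if "0 < f x" for x
        proof -
          have "0 \<le> rpow 0 r * \<omega>' * g y powr (1 / s)"
            using rpow_nonneg mu by simp
          then show ?thesis
            using hyp[OF supp_f[OF that] y, of 0] by (simp add: rpow_1 add.commute)
        qed
        then show ?thesis
          using integral_powr_le_of_affine_dominated[where t="(rpow 0 r * \<omega>') *\<^sub>R y", OF int(1,3) nonneg(1,3) mu(1) \<open>0 < s\<close>]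
          by (simp add: F_def H_def d_def)
      qed
      then have "(\<mu>' * F powr (1 / d)) powr p \<le> (H powr (1 / d)) powr p"
        using pos mu by (intro powr_mono2) auto
      then show ?thesis
        using 2 mu FGH \<open>0 < d\<close> by (simp add: root H_powr)
    next
      case 3
      \<comment> \<open>\<open>X\<close> and \<open>Y\<close> are chosen so that \<open>X powr p\<close> and \<open>Y powr p\<close> are the two terms of the claim.\<close>
      define X Y where "X = \<mu>' * F powr (1 / d)" and "Y = \<omega>' * G powr (1 / d)"
      have "0 < X" "0 < Y" using 3 mu by (simp_all add: X_def Y_def)
      then obtain t where t: "0 < t" "t < 1"
        and eq: "rpow (1 - t) r * X + rpow t r * Y = (X powr p + Y powr p) powr (1 / p)"
        unfolding r_def using holder_equality_weight[OF \<open>p \<ge> 1\<close>] by metis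
      have "rpow (1 - t) r * \<mu>' * F powr (1 / d) + rpow t r * \<omega>' * G powr (1 / d) \<le> H powr (1 / d)"
      proof -
        have "0 < rpow (1 - t) r * \<mu>'" "0 < rpow t r * \<omega>'"
          using t mu by (simp_all add: rpow_def)
        then show ?thesis
          using borell_brascamp_lieb[OF int nonneg, of "rpow (1 - t) r * \<mu>'" "rpow t r * \<omega>'" s]
            hyp[OF supp_f supp_g, of _ _ t] t \<open>0 < s\<close> 3
          by (simp add: F_def G_def H_def d_def)
      qed
      then have "(X powr p + Y powr p) powr (1 / p) \<le> H powr (1 / d)"
        unfolding eq[symmetric] by (simp add: X_def Y_def mult.assoc)
      then have "((X powr p + Y powr p) powr (1 / p)) powr p \<le> (H powr (1 / d)) powr p"
        using pos by (intro powr_mono2) auto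
      then have "X powr p + Y powr p \<le> H powr (p / d)"
        unfolding H_powr using pos by (simp add: powr_powr add_nonneg_nonneg)
      then show ?thesis
        using mu FGH by (simp add: X_def Y_def root)
    qed
  qed
  then show ?thesis
    unfolding F_def G_def H_def d_def .
qed

end
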